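(* Let $X$ be an $(n-1)$-dimensional subspace of the space $\ell_\infty^n$. Then $e(X)\geq 2^{\lfloor n/2\rfloor}$.
   Context: For a real finite-dimensional normed space $X$ with norm $\|\cdot\|$, a set $S\subset X$ is called equilateral if there is $p>0$ such that $\|x-y\|=p$ for all $x,y\in S$, $x\neq y$. The equilateral dimension $e(X)$ is the maximal cardinality of an equilateral set in $X$. $\ell_\infty^n$ is $\mathbb{R}^n$ with the norm $\|x\|_\infty=\max_i|x_i|$; subspaces are linear subspaces with the restricted norm. *)

theory Defs
  imports "HOL-Analysis.Analysis"
begin

definition equilateral :: "('a::real_vector \<Rightarrow> real) \<Rightarrow> 'a set \<Rightarrow> bool" where
  "equilateral N S \<longleftrightarrow> (\<exists>p>0. \<forall>x\<in>S. \<forall>y\<in>S. x \<noteq> y \<longrightarrow> N (x - y) = p)"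

text \<open>
  The normed space is a subspace \<open>X\<close> of the ambient type, with the norm \<open>N\<close> restricted to it.
  \<open>Max\<close> is meaningful only for a finite nonempty set, and \<open>card\<close> only for finite \<open>S\<close>.
  Both conditions hold in every finite-dimensional normed space; for \<open>infnorm\<close> they are
  proved below.
\<close>
definition equilateral_dim :: "('a::real_vector \<Rightarrow> real) \<Rightarrow> 'a set \<Rightarrow> nat" where
  "equilateral_dim N X = Max {card S | S. S \<subseteq> X \<and> equilateral N S}"

lemma equilateral_infnorm_bound:
  fixes S :: "(real ^ 'n) set"
  assumes "equilateral infnorm S"
  shows "finite S \<and> card S \<le> 2 ^ CARD('n)"
proof -
  obtain p where p: "p > 0" "\<And>x y. x \<in> S \<Longrightarrow> y \<in> S \<Longrightarrow> x \<noteq> y \<Longrightarrow> infnorm (x - y) = p"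
    using assms unfolding equilateral_def by blast
  have comp: "\<bar>x $ i - y $ i\<bar> \<le> p" if "x \<in> S" "y \<in> S" for x y i
  proof (cases "x = y")
    case False
    then show ?thesis using component_le_infnorm_cart[of "x - y" i] p(2) that by simp
  qed (use p(1) in simp)
  have ex: "\<exists>i. \<bar>x $ i - y $ i\<bar> = p" if xy: "x \<in> S" "y \<in> S" "x \<noteq> y" for x y
  proof -
    have "infnorm (x - y) \<in> (\<lambda>b. \<bar>(x - y) \<bullet> b\<bar>) ` Basis"
      unfolding infnorm_Max by (rule Max_in) auto
    then obtain b where b: "b \<in> Basis" "p = \<bar>(x - y) \<bullet> b\<bar>" using p(2)[OF xy] by auto
    then obtain i where "b = axis i 1" by (auto simp: Basis_vec_def)
    with b show ?thesis by (auto simp: inner_axis)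
  qed
  define F where "F x = {i. \<exists>y\<in>S. y $ i = x $ i + p}" for x
  have inj: "inj_on F S"
  proof (rule inj_onI, rule ccontr)
    fix x y assume xy: "x \<in> S" "y \<in> S" "F x = F y" "x \<noteq> y"
    have key: False if uv: "u \<in> S" "v \<in> S" "F u = F v" "v $ i = u $ i + p" for u v i
    proof -
      have "i \<in> F u" using uv unfolding F_def by blast
      then obtain w where "w \<in> S" "w $ i = v $ i + p" using uv(3) unfolding F_def by blast
      then show False using comp[of w u i] uv p(1) by simp
    qed
    obtain i where "\<bar>x $ i - y $ i\<bar> = p" using ex xy by blast
    then have "x $ i = y $ i + p \<or> y $ i = x $ i + p" by linarith
    then show False using key[of y x i] key[of x y i] xy(1-3) by auto
  qed
  have sub: "F ` S \<subseteq> (Pow UNIV :: 'n set set)" by simp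
  have fin: "finite S" using inj finite_imageD[of F S] by simp
  have "card S \<le> card (Pow UNIV :: 'n set set)"
    using card_inj_on_le[OF inj sub] by simp
  then show ?thesis using fin card_Pow[of "UNIV :: 'n set"] by simp
qed

lemma equilateral_dim_infnorm_attained:
  fixes X :: "(real ^ 'n) set"
  shows "\<exists>S\<subseteq>X. finite S \<and> equilateral infnorm S \<and> card S = equilateral_dim infnorm X"
    and "S \<subseteq> X \<Longrightarrow> equilateral infnorm S \<Longrightarrow> finite S \<and> card S \<le> equilateral_dim infnorm X"
proof -
  let ?C = "{card S | S. S \<subseteq> X \<and> equilateral infnorm S}"
  have "?C \<subseteq> {..2 ^ CARD('n)}" using equilateral_infnorm_bound by auto
  then have fin: "finite ?C" by (rule finite_subset) simp
  have "equilateral infnorm ({} :: (real ^ 'n) set)"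
    unfolding equilateral_def by (rule exI[of _ 1]) simp
  then have "?C \<noteq> {}" by blast
  then have "equilateral_dim infnorm X \<in> ?C"
    unfolding equilateral_dim_def using fin by (rule Max_in[rotated])
  then show "\<exists>S\<subseteq>X. finite S \<and> equilateral infnorm S \<and> card S = equilateral_dim infnorm X"
    using equilateral_infnorm_bound by (smt (verit) mem_Collect_eq)
  show "finite S \<and> card S \<le> equilateral_dim infnorm X" if "S \<subseteq> X" "equilateral infnorm S"
    unfolding equilateral_dim_def
    using that equilateral_infnorm_bound[OF that(2)] by (auto intro!: Max_ge fin)
qed

end

theory Submission
  imports Defs
begin

text \<open>
  Write the hyperplane as \<open>{x. a \<bullet> x = 0}\<close> and split the coordinates into two parts of sizes
  at least \<open>n div 2\<close>. On the part \<open>I\<close> where \<open>a\<close> has the smaller \<open>\<ell>\<^sub>1\<close>-norm, prescribe arbitrary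
  signs; the equation \<open>a \<bullet> x = 0\<close> can then be solved with the remaining coordinates in
  \<open>[-1, 1]\<close>. Any two of the resulting vectors are at distance exactly 2.
\<close>

lemma equilateral_dim_hyperplane_ge:
  fixes a :: "real ^ 'n" and I :: "'n set"
  assumes le: "(\<Sum>i\<in>I. \<bar>a $ i\<bar>) \<le> (\<Sum>i\<in>-I. \<bar>a $ i\<bar>)"
  shows "2 ^ card I \<le> equilateral_dim infnorm {x. a \<bullet> x = 0}"
proof -
  define s where "s A i = (if i \<in> A then 1 else - 1 :: real)" for A :: "'n set" and i
  define W where "W = (\<Sum>i\<in>-I. \<bar>a $ i\<bar>)"
  \<comment> \<open>If \<open>W = 0\<close> then \<open>a = 0\<close>, and the junk value \<open>t A = 0\<close> does no harm.\<close>
  define t where "t A = (\<Sum>i\<in>I. a $ i * s A i) / W" for A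
  \<comment> \<open>Off \<open>I\<close> each coordinate opposes the sign of \<open>a $ i\<close>,
    so together they contribute \<open>- W * t A\<close> to the inner product; \<open>t A\<close> is
    chosen to cancel the part from \<open>I\<close>.\<close>
  define f :: "'n set \<Rightarrow> real ^ 'n"
    where "f A = (\<chi> i. if i \<in> I then s A i else - sgn (a $ i) * t A)" for A
  have W0: "W \<ge> 0" unfolding W_def by (simp add: sum_nonneg)
  \<comment> \<open>The weight comparison \<open>le\<close> enters only here; it is what keeps
    \<open>t A\<close> in [-1, 1].\<close>
  have num: "\<bar>\<Sum>i\<in>I. a $ i * s A i\<bar> \<le> W" for A
  proof -
    have "\<bar>\<Sum>i\<in>I. a $ i * s A i\<bar> \<le> (\<Sum>i\<in>I. \<bar>a $ i\<bar>)"
      by (rule order_trans[OF sum_abs]) (auto simp: s_def intro!: sum_mono)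
    with le show ?thesis unfolding W_def by linarith
  qed
  have t1: "\<bar>t A\<bar> \<le> 1" for A
    using num[of A] W0 unfolding t_def by (simp add: divide_le_eq)
  have f1: "\<bar>f A $ i\<bar> \<le> 1" for A i
    using t1[of A] by (auto simp: f_def s_def abs_mult abs_sgn_eq)
  have mem: "f A \<in> {x. a \<bullet> x = 0}" for A
  proof -
    have "a \<bullet> f A = (\<Sum>i\<in>I. a $ i * f A $ i) + (\<Sum>i\<in>-I. a $ i * f A $ i)"
      unfolding inner_vec_def inner_real_def
      by (subst sum.union_disjoint[symmetric]) auto
    also have "(\<Sum>i\<in>I. a $ i * f A $ i) = (\<Sum>i\<in>I. a $ i * s A i)"
      by (rule sum.cong) (auto simp: f_def)
    also have "(\<Sum>i\<in>-I. a $ i * f A $ i) = (\<Sum>i\<in>-I. - (\<bar>a $ i\<bar> * t A))"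
      by (rule sum.cong) (auto simp: f_def abs_sgn)
    also have "\<dots> = - (W * t A)"
      unfolding W_def by (simp add: sum_negf sum_distrib_right)
    \<comment> \<open>If \<open>W = 0\<close>, then \<open>num\<close> forces the sum to vanish too,
      so division by zero is harmless.\<close>
    also have "W * t A = (\<Sum>i\<in>I. a $ i * s A i)"
      using num[of A] by (cases "W = 0") (auto simp: t_def)
    finally show ?thesis by simp
  qed
  have dist2: "infnorm (f A - f B) = 2" if AB: "A \<in> Pow I" "B \<in> Pow I" "A \<noteq> B" for A B
  proof (rule antisym)
    show "infnorm (f A - f B) \<le> 2"
      unfolding infnorm_cart
    proof (rule cSup_least)
      fix x assume "x \<in> {\<bar>(f A - f B) $ i\<bar> | i. i \<in> UNIV}"
      then obtain i where "x = \<bar>f A $ i - f B $ i\<bar>" by auto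
      then show "x \<le> 2" using f1[of A i] f1[of B i] by linarith
    qed auto
    \<comment> \<open>At such an \<open>i\<close> the two vectors have the opposite entries 1 and
      -1.\<close>
    obtain i where "i \<in> I" "(i \<in> A) \<noteq> (i \<in> B)" using AB by blast
    then have "\<bar>(f A - f B) $ i\<bar> = 2" by (auto simp: f_def s_def)
    then show "2 \<le> infnorm (f A - f B)"
      using component_le_infnorm_cart[of "f A - f B" i] by simp
  qed
  have "inj_on f (Pow I)"
  proof (rule inj_onI, rule ccontr)
    fix A B assume "A \<in> Pow I" "B \<in> Pow I" "f A = f B" "A \<noteq> B"
    then show False using dist2[of A B] by (simp add: infnorm_0)
  qed
  then have "card (f ` Pow I) = 2 ^ card I"
    by (simp add: card_image card_Pow)
  moreover have "equilateral infnorm (f ` Pow I)"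
    unfolding equilateral_def using dist2 by (intro exI[of _ 2]) auto
  ultimately show ?thesis
    using equilateral_dim_infnorm_attained(2)[of "f ` Pow I" "{x. a \<bullet> x = 0}"] mem by auto
qed

theorem corollary1p10:
  fixes X :: "(real ^ 'n) set"
  assumes "subspace X"
    and "dim X = CARD('n) - 1"
  shows "equilateral_dim infnorm X \<ge> 2 ^ (CARD('n) div 2)"
proof -
  \<comment> \<open>Strict despite truncated subtraction, because \<open>CARD('n)\<close> is
    positive.\<close>
  have "dim X < DIM(real ^ 'n)" using assms(2) by simp
  then obtain a :: "real ^ 'n" where a: "a \<noteq> 0" "span X \<subseteq> {x. a \<bullet> x = 0}"
    using lowdim_subset_hyperplane by blast
  have X: "X = {x. a \<bullet> x = 0}"
    using a assms span_superset[of X]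
    by (intro subspace_dim_equal) (auto simp: subspace_hyperplane dim_hyperplane)
  obtain I :: "'n set" where I: "card I = CARD('n) div 2"
    using obtain_subset_with_card_n[of "CARD('n) div 2" "UNIV :: 'n set"] by auto
  have "CARD('n) div 2 \<le> card (- I)"
    using I card_Diff_subset[of I UNIV] by (simp add: Compl_eq_Diff_UNIV)
  \<comment> \<open>\<open>J\<close> is \<open>I\<close> or its complement, whichever carries the
    smaller weight. For odd \<open>CARD('n)\<close> the complement has one element more, hence only
    a lower bound on \<open>card J\<close>.\<close>
  with I obtain J :: "'n set" where
    J: "CARD('n) div 2 \<le> card J" "(\<Sum>i\<in>J. \<bar>a $ i\<bar>) \<le> (\<Sum>i\<in>-J. \<bar>a $ i\<bar>)"
    by (metis double_complement linear order_refl)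
  have "(2::nat) ^ (CARD('n) div 2) \<le> 2 ^ card J"
    using J(1) by (rule power_increasing) simp
  also have "\<dots> \<le> equilateral_dim infnorm X"
    unfolding X by (rule equilateral_dim_hyperplane_ge[OF J(2)])
  finally show ?thesis .
qed

end
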